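(* If $P$ is a cubical poset with nonnegative cubical $h$-vector, then the chain polynomial of $P$ is real-rooted. Moreover, if $S$ is a set of positive integers, then the chain polynomial of $P_S=\{x\in P:\rho(x)\in S\}$ is real-rooted.
   Context: Cubical posets: let $M_2$ be the poset consisting of an antichain $\{1,2\}$ together with a largest element $z$. Let $\mathbf{C}_2$ consist of a least element $\hat0$ together with all sequences $x=(\xi_1,\xi_2,\dots)$ with $\xi_i\in M_2$ and $\xi_i\in\{1,2\}$ for all but finitely many $i$, ordered coordinatewise. The rank of a sequence $x$ is $\rho(x)=1+|\{i:\xi_i=z\}|$ and $\rho(\hat0)=0$. For $x\in\mathbf{C}_2$ of rank $n$, the interval $[\hat0,x]$ is a ($2$-)cube of rank $n$. A finite poset $P$ with a least element $\hat0$ is cubical if every principal order ideal $\{z'\in P:z'\le x\}$, $x\in P$, is isomorphic to such a cube; $\rho(x)$ is the rank of that cube and the rank of $P$ is the maximal rank of an element. Cubical $h$-vector: let $P$ be a cubical poset of rank $n$ and $f_P(t)=\sum_{x\in P}t^{\rho(x)}$. The (normalized) cubical $h$-vector $(h_0(P),\dots,h_n(P))$ is defined by $h_P(t)=\sum_{i=0}^n h_i(P)t^i$ and $$(1+t)h_P(t)=(-1)^nf_P(-1)t^{n+1}+f_P(0)\left(1-\left(\tfrac{1-t}{2}\right)^n\right)+\left(\tfrac{1-t}{2}\right)^nf_P\!\left(\tfrac{2t}{1-t}\right).$$ It is nonnegative if all $h_i(P)\ge0$. The chain polynomial of a finite poset $Q$ is $c_Q(t)=\sum_C t^{|C|}$,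 the sum over all chains $C$ in $Q$ (including the empty one). Real-rooted means all complex zeros are real (nonzero constants count as real-rooted). *)

theory Defs
  imports "HOL-Computational_Algebra.Polynomial" "HOL-Library.Option_ord" "HOL-Library.FuncSet"
begin

text \<open>
  A poset is a relation \<open>r\<close> with \<open>Partial_order r\<close>; its ground set is \<open>Field r\<close>, and the induced
  subposet on \<open>B\<close> is \<open>Restr r B\<close>. Isomorphisms are those of \<^const>\<open>iso\<close>, which is not specific to
  well-orders: see \<open>iso_iff2\<close>.
\<close>


section \<open>The poset of cubes\<close>

datatype m2 = M_one | M_two | M_z

instantiation m2 :: order
begin

definition less_eq_m2 :: "m2 \<Rightarrow> m2 \<Rightarrow> bool" where
  "a \<le> b \<longleftrightarrow> a = b \<or> b = M_z"

definition less_m2 :: "m2 \<Rightarrow> m2 \<Rightarrow> bool" where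
  "(a :: m2) < b \<longleftrightarrow> a \<le> b \<and> \<not> b \<le> a"

instance
  by standard (auto simp: less_eq_m2_def less_m2_def)

end

text \<open>
  \<^term>\<open>None\<close> is the least element. The order used below is the one of \<open>HOL-Library.Option_ord\<close>
  over the pointwise order on functions.
\<close>

definition C2 :: "(nat \<Rightarrow> m2) option set" where
  "C2 = insert None (Some ` {x. finite {i. x i \<notin> {M_one, M_two}}})"

definition C2_rel :: "(nat \<Rightarrow> m2) option rel" where
  "C2_rel = relation_of (\<le>) C2"

fun C2_rank :: "(nat \<Rightarrow> m2) option \<Rightarrow> nat" where
  "C2_rank None = 0"
| "C2_rank (Some x) = 1 + card {i. x i = M_z}"


section \<open>Cubical posets\<close>

definition principal_ideal :: "'a rel \<Rightarrow> 'a \<Rightarrow> 'a rel" where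
  "principal_ideal r x = Restr r (under r x)"

definition is_cube :: "nat \<Rightarrow> 'a rel \<Rightarrow> bool" where
  "is_cube n r \<longleftrightarrow> (\<exists>c\<in>C2. C2_rank c = n \<and> (\<exists>f. iso r (principal_ideal C2_rel c) f))"

definition cubical_poset :: "'a rel \<Rightarrow> bool" where
  "cubical_poset r \<longleftrightarrow>
     Partial_order r \<and> finite (Field r) \<and>
     (\<exists>b\<in>Field r. \<forall>x\<in>Field r. (b, x) \<in> r) \<and>
     (\<forall>x\<in>Field r. \<exists>n. is_cube n (principal_ideal r x))"

definition elem_rank :: "'a rel \<Rightarrow> 'a \<Rightarrow> nat" where
  "elem_rank r x = (THE n. is_cube n (principal_ideal r x))"

definition poset_rank :: "'a rel \<Rightarrow> nat" where
  "poset_rank r = Max (elem_rank r ` Field r)"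


section \<open>The cubical h-vector\<close>

definition f_poly :: "'a rel \<Rightarrow> real poly" where
  "f_poly r = (\<Sum>x\<in>Field r. monom 1 (elem_rank r x))"

definition is_h_poly :: "'a rel \<Rightarrow> real poly \<Rightarrow> bool" where
  "is_h_poly r h \<longleftrightarrow>
     (\<forall>t. t \<noteq> 1 \<longrightarrow>
        (1 + t) * poly h t =
          (-1) ^ poset_rank r * poly (f_poly r) (-1) * t ^ (poset_rank r + 1)
          + poly (f_poly r) 0 * (1 - ((1 - t) / 2) ^ poset_rank r)
          + ((1 - t) / 2) ^ poset_rank r * poly (f_poly r) (2 * t / (1 - t)))"

definition h_poly :: "'a rel \<Rightarrow> real poly" where
  "h_poly r = (THE h. is_h_poly r h)"

definition nonneg_h_vector :: "'a rel \<Rightarrow> bool" where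
  "nonneg_h_vector r \<longleftrightarrow> (\<forall>i\<le>poset_rank r. coeff (h_poly r) i \<ge> 0)"


section \<open>Chain polynomials\<close>

definition chain_poly :: "'a rel \<Rightarrow> real poly" where
  "chain_poly r = (\<Sum>C\<in>Chains r. monom 1 (card C))"

definition rank_selected :: "'a rel \<Rightarrow> nat set \<Rightarrow> 'a rel" where
  "rank_selected r S = Restr r {x\<in>Field r. elem_rank r x \<in> S}"

definition real_rooted :: "real poly \<Rightarrow> bool" where
  "real_rooted p \<longleftrightarrow> (\<forall>z. poly (map_poly complex_of_real p) z = 0 \<longrightarrow> z \<in> \<real>)"


section \<open>Well-definedness of the rank and of the h-polynomial\<close>

lemma Field_principal_ideal:
  assumes "Partial_order r" "x \<in> Field r"
  shows "Field (principal_ideal r x) = under r x"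
  using assms unfolding principal_ideal_def order_on_defs refl_on_def under_def Field_def
  by blast

lemma Field_C2_rel: "Field C2_rel = C2"
  by (auto simp: C2_rel_def relation_of_def Field_def)

lemma Partial_order_C2_rel: "Partial_order C2_rel"
  unfolding Field_C2_rel order_on_defs
  by (auto simp: C2_rel_def relation_of_def refl_on_def intro!: transI antisymI)

lemma card_seqs_below:
  fixes x :: "nat \<Rightarrow> m2"
  assumes fin: "finite {i. x i = M_z}"
  shows "finite {y. y \<le> x} \<and> card {y. y \<le> x} = 3 ^ card {i. x i = M_z}"
proof -
  let ?K = "{i. x i = M_z}"
  have "a \<in> {M_one, M_two, M_z}" for a
    by (cases a) auto
  then have U: "(UNIV :: m2 set) = {M_one, M_two, M_z}"
    by blast
  have bij: "bij_betw (\<lambda>y i. if i \<in> ?K then y i else x i) (?K \<rightarrow>\<^sub>E (UNIV :: m2 set)) {y. y \<le> x}"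
  proof (rule bij_betw_byWitness[where f' = "\<lambda>y. restrict y ?K"])
    show "(\<lambda>y i. if i \<in> ?K then y i else x i) ` (?K \<rightarrow>\<^sub>E UNIV) \<subseteq> {y. y \<le> x}"
      by (auto simp: le_fun_def less_eq_m2_def)
    show "\<forall>y\<in>{y. y \<le> x}. (\<lambda>i. if i \<in> ?K then restrict y ?K i else x i) = y"
      unfolding le_fun_def less_eq_m2_def by (auto simp: fun_eq_iff) metis
  qed (auto simp: fun_eq_iff PiE_def extensional_def)
  have "finite (?K \<rightarrow>\<^sub>E (UNIV :: m2 set))"
    using fin by (intro finite_PiE) (auto simp: U)
  moreover have "card (?K \<rightarrow>\<^sub>E (UNIV :: m2 set)) = 3 ^ card ?K"
  proof -
    have "card (UNIV :: m2 set) = 3"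
      unfolding U by (simp add: eval_nat_numeral)
    then show ?thesis using fin by (simp add: card_PiE)
  qed
  ultimately show ?thesis
    using bij_betw_finite[OF bij] bij_betw_same_card[OF bij] by simp
qed

lemma card_cube:
  assumes "c \<in> C2"
  shows "card (under C2_rel c) = (if C2_rank c = 0 then 1 else Suc (3 ^ (C2_rank c - 1)))"
proof (cases c)
  case None
  then have "under C2_rel c = {None}"
    by (auto simp: under_def C2_rel_def relation_of_def C2_def)
  then show ?thesis using None by simp
next
  case (Some x)
  have E: "a \<notin> {M_one, M_two} \<longleftrightarrow> a = M_z" for a
    by (cases a) auto
  have fin: "finite {i. x i = M_z}"
    using assms Some unfolding C2_def E by auto
  have sub: "finite {i. y i = M_z}" if "y \<le> x" for y
    by (rule finite_subset[OF _ fin]) (use that in \<open>force simp: le_fun_def less_eq_m2_def\<close>)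
  have "under C2_rel c = insert None (Some ` {y. y \<le> x})"
    using Some fin sub unfolding under_def C2_rel_def relation_of_def C2_def E
    by auto
  then show ?thesis
    using Some card_seqs_below[OF fin] by (simp add: card_image)
qed

lemma is_cube_unique:
  assumes "is_cube m r" "is_cube n r"
  shows "m = n"
proof -
  have *: "card (Field r) = (if k = 0 then 1 else Suc (3 ^ (k - 1)))" if cube: "is_cube k r" for k
  proof -
    obtain c f where c: "c \<in> C2" "C2_rank c = k" "iso r (principal_ideal C2_rel c) f"
      using cube unfolding is_cube_def by blast
    then have "card (Field r) = card (under C2_rel c)"
      using Field_principal_ideal[OF Partial_order_C2_rel, of c] Field_C2_rel
      by (auto simp: iso_def dest: bij_betw_same_card)
    then show ?thesis using card_cube[OF c(1)] c(2) by simp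
  qed
  show ?thesis
    using *[OF assms(1)] *[OF assms(2)]
    by (cases m; cases n) auto
qed

lemma elem_rank_eq:
  assumes "is_cube n (principal_ideal r x)"
  shows "elem_rank r x = n"
  unfolding elem_rank_def using assms is_cube_unique by blast

lemma is_h_poly_unique:
  assumes "is_h_poly r g" "is_h_poly r h"
  shows "g = h"
proof -
  have "poly g t = poly h t" if "t \<noteq> 1" "t \<noteq> -1" for t
  proof -
    have "(1 + t) * poly g t = (1 + t) * poly h t"
      using assms that(1) unfolding is_h_poly_def by metis
    then show ?thesis using that(2) by (simp add: add_eq_0_iff)
  qed
  then have "UNIV - {1, -1} \<subseteq> {t. poly (g - h) t = 0}"
    by auto
  moreover have "infinite (UNIV - {1, -1 :: real})"
    by (simp add: infinite_UNIV_char_0)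
  ultimately have "infinite {t. poly (g - h) t = 0}"
    using infinite_super by blast
  then show ?thesis
    using poly_roots_finite[of "g - h"] by auto
qed

lemma is_h_poly_exists:
  assumes "finite (Field r)"
  shows "\<exists>h. is_h_poly r h \<and> degree h \<le> poset_rank r"
proof -
  define n where "n = poset_rank r"
  define f where "f = f_poly r"
  define q where "q = [:1/2, -1/2 :: real:]"
  define R where "R = monom ((-1) ^ n * poly f (-1)) (Suc n) + smult (poly f 0) (1 - q ^ n)
      + (\<Sum>x\<in>Field r. monom 1 (elem_rank r x) * q ^ (n - elem_rank r x))"
  have le: "elem_rank r x \<le> n" if "x \<in> Field r" for x
    unfolding n_def poset_rank_def using assms that by simp
  have q: "poly q t = (1 - t) / 2" for t
    by (simp add: q_def field_simps)
  have pf: "poly f t = (\<Sum>x\<in>Field r. t ^ elem_rank r x)" for t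
    by (simp add: f_def f_poly_def poly_sum poly_monom)
  have R: "poly R t = (-1) ^ n * poly f (-1) * t ^ (n + 1)
          + poly f 0 * (1 - ((1 - t) / 2) ^ n)
          + ((1 - t) / 2) ^ n * poly f (2 * t / (1 - t))" if "t \<noteq> 1" for t
  proof -
    have *: "t ^ k * ((1 - t) / 2) ^ (n - k) = ((1 - t) / 2) ^ n * (2 * t / (1 - t)) ^ k"
      if "k \<le> n" for k
    proof -
      have "((1 - t) / 2) ^ n = ((1 - t) / 2) ^ (n - k) * ((1 - t) / 2) ^ k"
        using that by (simp only: power_add [symmetric] le_add_diff_inverse2)
      then have "((1 - t) / 2) ^ n * (2 * t / (1 - t)) ^ k
          = ((1 - t) / 2) ^ (n - k) * ((1 - t) / 2 * (2 * t / (1 - t))) ^ k"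
        by (simp only: power_mult_distrib mult.assoc)
      also have "(1 - t) / 2 * (2 * t / (1 - t)) = t"
        using \<open>t \<noteq> 1\<close> by simp
      finally show ?thesis by (simp only: mult.commute)
    qed
    have "(\<Sum>x\<in>Field r. t ^ elem_rank r x * ((1 - t) / 2) ^ (n - elem_rank r x))
        = ((1 - t) / 2) ^ n * poly f (2 * t / (1 - t))"
      unfolding pf sum_distrib_left using le by (intro sum.cong refl *)
    then show ?thesis
      unfolding R_def by (simp only: poly_add poly_diff poly_smult poly_mult poly_power poly_1
        poly_sum poly_monom q mult_1 Suc_eq_plus1)
  qed
  have "poly R (-1) = 0"
  proof -
    have "(-1) ^ n * poly f (-1) * (-1) ^ (n + 1) = - poly f (-1)"
      by (cases "even n") simp_all
    then show ?thesis using R[of "-1"] by simp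
  qed
  then obtain h where h: "R = [:1, 1:] * h"
    using poly_eq_0_iff_dvd[of R "-1"] by (auto elim: dvdE)
  have dq: "degree (q ^ k) \<le> k" for k
    using degree_power_le[of q k] by (simp add: q_def)
  have "degree R \<le> Suc n"
    unfolding R_def
  proof (intro degree_add_le degree_sum_le)
    show "degree (smult (poly f 0) (1 - q ^ n)) \<le> Suc n"
      by (rule order.trans[OF degree_smult_le]) (intro degree_diff_le, use dq[of n] in auto)
    show "degree (monom 1 (elem_rank r x) * q ^ (n - elem_rank r x)) \<le> Suc n"
      if "x \<in> Field r" for x
      by (rule order.trans[OF degree_mult_le])
         (use dq[of "n - elem_rank r x"] le[OF that] in \<open>simp add: degree_monom_eq\<close>)
  qed (auto simp: assms degree_monom_le)
  then have "degree h \<le> n"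
    using h by (cases "h = 0") (auto simp: degree_mult_eq simp del: mult_pCons_left)
  moreover have "is_h_poly r h"
    unfolding is_h_poly_def
  proof (intro allI impI)
    fix t :: real assume "t \<noteq> 1"
    have "(1 + t) * poly h t = poly R t" by (simp add: h algebra_simps)
    with R[OF \<open>t \<noteq> 1\<close>] show "(1 + t) * poly h t =
          (-1) ^ poset_rank r * poly (f_poly r) (-1) * t ^ (poset_rank r + 1)
          + poly (f_poly r) 0 * (1 - ((1 - t) / 2) ^ poset_rank r)
          + ((1 - t) / 2) ^ poset_rank r * poly (f_poly r) (2 * t / (1 - t))"
      unfolding n_def f_def by simp
  qed
  ultimately show ?thesis unfolding n_def by blast
qed

lemma is_h_poly_h_poly:
  assumes "finite (Field r)"
  shows "is_h_poly r (h_poly r)" and "degree (h_poly r) \<le> poset_rank r"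
proof -
  obtain h where h: "is_h_poly r h" "degree h \<le> poset_rank r"
    using is_h_poly_exists[OF assms] by blast
  then have "h_poly r = h"
    unfolding h_poly_def using is_h_poly_unique by blast
  with h show "is_h_poly r (h_poly r)" "degree (h_poly r) \<le> poset_rank r" by auto
qed

end

theory Submission
  imports Defs
begin

text \<open>
  Fix \<open>z\<close> in the open upper half plane. Since the number of elements of each rank below \<open>x\<close> depends
  only on the rank of \<open>x\<close>, the chain polynomial of \<open>P\<^sub>S\<close> at \<open>z\<close> is the image of the \<open>f\<close>-polynomial
  of \<open>P\<close> under a linear functional \<open>L\<close> that depends on \<open>z\<close> and \<open>S\<close> but not on \<open>P\<close>. The \<open>f\<close>-polynomial is
  \<open>h\<^sub>0 g\<^sub>0 + \<dots> + h\<^sub>n g\<^sub>n\<close>, where \<open>g\<^sub>0 = 1 + s (2 + s)\<^sup>n\<^sup>-\<^sup>1\<close>, \<open>g\<^sub>n = s\<^sup>n\<close> and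
  \<open>g\<^sub>i = 2 (1 + s) s\<^sup>i (2 + s)\<^sup>n\<^sup>-\<^sup>1\<^sup>-\<^sup>i\<close> for \<open>0 < i < n\<close>. Up to the factors \<open>2\<close>, the
  basis of rank \<open>n + 1\<close> consists of the tail sums of the basis of rank \<open>n\<close> plus \<open>s\<^sup>n\<^sup>+\<^sup>1\<close>. By induction
  along this recursion, the numbers \<open>L(g\<^sub>0), \<dots>, L(g\<^sub>n)\<close> are ordered by argument inside the pointed
  cone spanned by \<open>L(g\<^sub>0) \<noteq> 0\<close> and \<open>z / (1 + z) L(g\<^sub>0)\<close>, so no nonnegative combination with \<open>h\<^sub>0 > 0\<close>
  vanishes. This pointwise ordering replaces the usual interlacing of zeros.
\<close>

section \<open>Complex numbers ordered by argument\<close>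

text \<open>For \<open>y\<close> in the upper half plane, arguments do not decrease from
  \<open>w i\<close> to \<open>w j\<close> and do not pass that of \<open>y * w i\<close>. As signs
  of sesquilinear forms these conditions pass to sums and admit zero entries after
  \<open>w 0\<close>.\<close>

definition sector_ordered :: "complex \<Rightarrow> (nat \<Rightarrow> complex) \<Rightarrow> nat \<Rightarrow> bool" where
  "sector_ordered y w n \<longleftrightarrow> w 0 \<noteq> 0 \<and>
     (\<forall>i j. i \<le> j \<longrightarrow> j \<le> n \<longrightarrow> 0 \<le> Im (w j * cnj (w i)) \<and> 0 \<le> Im (y * w i * cnj (w j)))"

lemma Im_mult_cnj_scale: "Im (c * a * cnj (c * b)) = (cmod c)\<^sup>2 * Im (a * cnj b)"
  unfolding cmod_power2 by (simp add: algebra_simps power2_eq_square)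

lemma Im_mult_cnj_self_nonneg: "0 < Im y \<Longrightarrow> 0 \<le> Im (y * (x * cnj x))"
  by (simp add: mult_nonneg_nonneg)

lemma sector_ordered_scale:
  assumes "sector_ordered y w n" "c \<noteq> 0"
  shows "sector_ordered y (\<lambda>i. c * w i) n"
proof -
  have "Im (y * (c * a) * cnj (c * b)) = (cmod c)\<^sup>2 * Im (y * a * cnj b)" for a b
    using Im_mult_cnj_scale[of c "y * a" b] by (simp only: mult_ac)
  then show ?thesis
    using assms unfolding sector_ordered_def by (simp only: Im_mult_cnj_scale) simp
qed

lemma sector_ordered_weights:
  assumes "sector_ordered y w n" "\<And>i. i \<le> n \<Longrightarrow> 0 \<le> d i" "d 0 \<noteq> 0"
  shows "sector_ordered y (\<lambda>i. of_real (d i) * w i) n"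
proof -
  have 1: "Im (of_real (d j) * w j * cnj (of_real (d i) * w i)) = d j * d i * Im (w j * cnj (w i))"
   and 2: "Im (y * (of_real (d i) * w i) * cnj (of_real (d j) * w j)) = d j * d i * Im (y * w i * cnj (w j))" for i j
    by (simp_all add: algebra_simps)
  show ?thesis
    using assms unfolding sector_ordered_def 1 2 by auto
qed

lemma sector_ordered_cong:
  assumes "sector_ordered y v n" "\<And>i. i \<le> n \<Longrightarrow> w i = v i"
  shows "sector_ordered y w n"
  using assms unfolding sector_ordered_def by auto

lemma sector_ordered_sum:
  assumes "sector_ordered y w n" "J \<subseteq> {..n}" "\<And>i j. i \<in> I \<Longrightarrow> j \<in> J \<Longrightarrow> i \<le> j"
  shows "0 \<le> Im (sum w J * cnj (sum w I))" "0 \<le> Im (y * sum w I * cnj (sum w J))"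
proof -
  have "sum w J * cnj (sum w I) = (\<Sum>j\<in>J. \<Sum>i\<in>I. w j * cnj (w i))"
    and "y * sum w I * cnj (sum w J) = (\<Sum>i\<in>I. \<Sum>j\<in>J. y * w i * cnj (w j))"
    unfolding sum_distrib_left[of y w] cnj_sum sum_product by (rule refl)+
  moreover have "0 \<le> Im (w j * cnj (w i))" "0 \<le> Im (y * w i * cnj (w j))" if "i \<in> I" "j \<in> J" for i j
    using assms that unfolding sector_ordered_def by blast+
  ultimately show "0 \<le> Im (sum w J * cnj (sum w I))" "0 \<le> Im (y * sum w I * cnj (sum w J))"
    by (simp_all only: Im_sum sum_nonneg)
qed

text \<open>Pairing with \<open>y * w 0\<close> gives each entry a nonnegative imaginary part, and a
  strictly positive one to \<open>w 0\<close>, so the entries cannot cancel.\<close>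

lemma sector_ordered_sum_nonzero:
  assumes "sector_ordered y w n" "0 < Im y"
  shows "(\<Sum>i\<le>n. w i) \<noteq> 0"
proof
  assume 0: "(\<Sum>i\<le>n. w i) = 0"
  have "0 < Im (y * (w 0 * cnj (w 0)))"
    using assms unfolding sector_ordered_def complex_norm_square[symmetric] by simp
  also have "\<dots> \<le> (\<Sum>i\<le>n. Im (y * w 0 * cnj (w i)))"
    using member_le_sum[of 0 "{..n}" "\<lambda>i. Im (y * w 0 * cnj (w i))"] assms
    unfolding sector_ordered_def by (simp add: mult.assoc del: times_complex.sel)
  also have "\<dots> = Im (y * w 0 * cnj (\<Sum>i\<le>n. w i))"
    by (simp add: sum_distrib_left del: times_complex.sel)
  also have "\<dots> = 0" by (simp add: 0 del: times_complex.sel)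
  finally show False by simp
qed

text \<open>One step of the recursion in the rank: \<open>e = y\<close> when the new rank is
  selected, \<open>e = 0\<close> when it is not.\<close>

lemma sector_ordered_tails:
  assumes ord: "sector_ordered y w n" and y: "0 < Im y" and e: "e = 0 \<or> e = y"
  shows "sector_ordered y (\<lambda>i. sum w {i..n} + e * sum w {..<i}) (Suc n)"
  unfolding sector_ordered_def
proof (intro conjI allI impI)
  have "sum w {0..n} \<noteq> 0"
    using sector_ordered_sum_nonzero[OF ord y] by (simp add: atLeast0AtMost)
  then show "sum w {0..n} + e * sum w {..<0} \<noteq> 0" by simp
next
  fix i j assume ij: "i \<le> j" "j \<le> Suc n"
  \<comment> \<open>Entry \<open>i\<close> is \<open>A + P + e * C\<close> and entry
    \<open>j\<close> is \<open>P + e * (C + A)\<close>: they differ only in the factor at the middle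
    block.\<close>
  define P A C where "P = sum w {j..n}" and "A = sum w {i..<j}" and "C = sum w {..<i}"
  have "{i..n} = {i..<j} \<union> {j..n}" using ij by auto
  then have i: "sum w {i..n} = A + P"
    unfolding P_def A_def by (simp add: sum.union_disjoint ivl_disj_int)
  have "{..<j} = {..<i} \<union> {i..<j}" using ij by auto
  then have j: "sum w {..<j} = C + A"
    unfolding C_def A_def by (simp add: sum.union_disjoint ivl_disj_int)
  have PA: "0 \<le> Im (P * cnj A)" "0 \<le> Im (y * A * cnj P)"
    unfolding P_def A_def using ij by (intro sector_ordered_sum[OF ord]; auto)+
  have AC: "0 \<le> Im (A * cnj C)" "0 \<le> Im (y * C * cnj A)"
    unfolding C_def A_def using ij by (intro sector_ordered_sum[OF ord]; auto)+
  have sq: "0 \<le> Im (y * (x * cnj x))" for x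
    using y by (rule Im_mult_cnj_self_nonneg)
  have yy: "0 \<le> Im (y * a * cnj (y * b))" if "0 \<le> Im (a * cnj b)" for a b
    using that unfolding Im_mult_cnj_scale by simp
  note [simp del] = times_complex.sel
  have "0 \<le> Im ((P + e * (C + A)) * cnj (A + P + e * C)) \<and>
        0 \<le> Im (y * (A + P + e * C) * cnj (P + e * (C + A)))"
    using e
  proof
    assume "e = 0"
    then show ?thesis using PA sq[of P]
      by (simp add: algebra_simps Im_mult_cnj_scale)
  next
    assume e: "e = y"
    \<comment> \<open>All products of the outer blocks \<open>P\<close> and \<open>C\<close> are
      absorbed in \<open>D * cnj D\<close>. The other terms involve \<open>A\<close> and are
      controlled by \<open>PA\<close>, \<open>AC\<close> or \<open>sq\<close>, or have imaginary
      part zero.\<close>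
    define D where "D = P + y * C"
    have 1: "(P + e * (C + A)) * cnj (A + P + e * C)
      = D * cnj D + y * (A * cnj A) + P * cnj A + y * C * cnj A + y * A * cnj P + y * A * cnj (y * C)"
      unfolding D_def e by (simp add: algebra_simps)
    have 2: "y * (A + P + e * C) * cnj (P + e * (C + A))
      = y * (D * cnj D) + y * A * cnj P + y * A * cnj (y * C) + y * A * cnj (y * A)
        + y * P * cnj (y * A) + y * (y * C) * cnj (y * A)"
      unfolding D_def e by (simp add: algebra_simps)
    have "Im (x * cnj x) = 0" for x by (simp add: times_complex.sel)
    moreover have "Im (y * A * cnj (y * A)) = 0" by (simp add: times_complex.sel algebra_simps)
    ultimately show ?thesis unfolding 1 2 plus_complex.sel
      using PA AC sq[of A] sq[of D] yy[OF PA(1)] yy[OF AC(1)] yy[OF AC(2)]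
      by (simp add: add_nonneg_nonneg)
  qed
  then show "0 \<le> Im ((sum w {j..n} + e * sum w {..<j}) * cnj (sum w {i..n} + e * sum w {..<i}))"
    and "0 \<le> Im (y * (sum w {i..n} + e * sum w {..<i}) * cnj (sum w {j..n} + e * sum w {..<j}))"
    unfolding i j P_def[symmetric] C_def[symmetric] by blast+
qed

section \<open>The basis dual to the cubical h-vector\<close>

text \<open>Polymorphic, so that it can be used at the polynomial \<open>pX\<close>, at real numbers
  and, for counting, at \<open>1 :: int\<close>.\<close>

definition cube_basis :: "nat \<Rightarrow> nat \<Rightarrow> 'a::comm_ring_1 \<Rightarrow> 'a" where
  "cube_basis n i s =
     (if i = 0 then (if n = 0 then 1 else 1 + s * (2 + s) ^ (n - 1))
      else if i = n then s ^ n else (1 + s) * s ^ i * (2 + s) ^ (n - 1 - i))"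

definition cube_mult :: "nat \<Rightarrow> nat \<Rightarrow> 'a::comm_ring_1" where
  "cube_mult n i = (if 0 < i \<and> i < n then 2 else 1)"

text \<open>For \<open>0 < i < n\<close>, one factor \<open>2 + s\<close> is split into
  \<open>2\<close>, which yields \<open>cube_mult\<close>, and \<open>s\<close>, which yields the
  next member. For \<open>i = 0 < n\<close> the split is \<open>1 + (1 + s)\<close>, and for
  \<open>i = n\<close> the factor \<open>1 + s\<close> is split.\<close>

lemma cube_basis_Suc_step:
  assumes "i \<le> n"
  shows "cube_basis (Suc n) i s = cube_mult n i * cube_basis n i s + cube_basis (Suc n) (Suc i) s"
proof -
  consider "i = 0" "n = 0" | m where "i = 0" "n = Suc m" | "0 < i" "i = n"
    | m where "0 < i" "n = Suc (i + m)"
    using assms by (metis Suc_diff_Suc add_Suc_right le_add_diff_inverse le_neq_implies_less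
        not0_implies_Suc zero_less_iff_neq_zero)
  then show ?thesis
    by cases (auto simp: cube_basis_def cube_mult_def algebra_simps)
qed

lemma cube_basis_Suc:
  assumes "i \<le> Suc n"
  shows "cube_basis (Suc n) i s = (\<Sum>k=i..n. cube_mult n k * cube_basis n k s) + s ^ Suc n"
  using assms
proof (induction rule: inc_induct)
  case base
  then show ?case by (simp add: cube_basis_def)
next
  case (step i)
  then show ?case
    by (simp add: cube_basis_Suc_step sum.atLeast_Suc_atMost add.assoc del: power_Suc)
qed

text \<open>
  An \<open>f\<close>-polynomial of rank \<open>n\<close> equal to \<open>h_basis n i\<close> has \<open>h\<close>-polynomial \<open>t\<^sup>i\<close>; the rescaled version
  \<open>cube_basis n i\<close> is the one with the clean recursion. For \<open>i = 0\<close> it is the \<open>f\<close>-polynomial of the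
  cube of rank \<open>n\<close>.
\<close>

definition h_basis :: "nat \<Rightarrow> nat \<Rightarrow> 'a::comm_ring_1 \<Rightarrow> 'a" where
  "h_basis n i s = cube_mult n i * cube_basis n i s"

abbreviation pX :: "real poly" where "pX \<equiv> monom 1 1"

lemma pX_power: "pX ^ n = monom 1 n"
  by (simp add: monom_power)

lemma degree_cube_basis_le:
  assumes "i \<le> n"
  shows "degree (cube_basis n i pX) \<le> n"
proof -
  have 2: "degree (2 + pX) \<le> 1" and 1: "degree (1 + pX) \<le> 1"
    by (auto intro!: degree_add_le simp: degree_monom_eq)
  have p: "degree ((2 + pX) ^ k) \<le> k" for k
    using degree_power_le[of "2 + pX" k] 2
    by (metis mult_le_mono1 nat_mult_1 order.trans)
  have X: "degree (pX ^ k) \<le> k" for k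
    by (simp only: pX_power degree_monom_le)
  consider "i = 0" "n = 0" | "i = 0" "0 < n" | "0 < i" "i = n" | "0 < i" "i < n"
    using assms by linarith
  then show ?thesis
  proof cases
    case 2
    have "degree (pX * (2 + pX) ^ (n - 1)) \<le> n"
      using degree_mult_le[of pX "(2 + pX) ^ (n - 1)"] p[of "n - 1"] X[of 1] 2 by simp
    then show ?thesis
      using 2 by (simp add: cube_basis_def degree_add_le)
  next
    case 4
    have "degree ((1 + pX) * pX ^ i * (2 + pX) ^ (n - 1 - i)) \<le> 1 + i + (n - 1 - i)"
      by (rule order.trans[OF degree_mult_le] add_mono p order.trans[OF degree_mult_le] 1 X)+
    then show ?thesis
      using 4 by (simp add: cube_basis_def)
  qed (use X in \<open>simp_all add: cube_basis_def\<close>)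
qed

text \<open>Ensures that the coefficients up to \<open>n\<close> used in \<open>rank_weight\<close>
  are all of them.\<close>

lemma degree_h_basis_le:
  assumes "i \<le> n"
  shows "degree (h_basis n i pX) \<le> n"
proof -
  have "degree (cube_mult n i :: real poly) = 0" by (simp add: cube_mult_def)
  then show ?thesis
    unfolding h_basis_def using degree_mult_le[of "cube_mult n i" "cube_basis n i pX"]
      degree_cube_basis_le[OF assms] by simp
qed

section \<open>Linear functionals on polynomials and their values on the basis\<close>

definition umbral :: "(nat \<Rightarrow> complex) \<Rightarrow> real poly \<Rightarrow> complex" where
  "umbral u p = (\<Sum>j\<le>degree p. of_real (coeff p j) * u j)"

lemma umbral_altdef:
  assumes "degree p \<le> n"
  shows "umbral u p = (\<Sum>j\<le>n. of_real (coeff p j) * u j)"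
  unfolding umbral_def
  by (rule sum.mono_neutral_left) (use assms in \<open>auto simp: coeff_eq_0\<close>)

lemma umbral_add: "umbral u (p + q) = umbral u p + umbral u q"
proof -
  define n where "n = max (degree p) (degree q)"
  have "degree p \<le> n" "degree q \<le> n" "degree (p + q) \<le> n"
    unfolding n_def by (auto intro: degree_add_le_max)
  then show ?thesis
    by (simp add: umbral_altdef[of _ n] sum.distrib algebra_simps)
qed

lemma umbral_sum: "umbral u (\<Sum>x\<in>A. f x) = (\<Sum>x\<in>A. umbral u (f x))"
  by (induction A rule: infinite_finite_induct) (simp_all add: umbral_add, simp_all add: umbral_def)

lemma umbral_smult: "umbral u (smult c p) = of_real c * umbral u p"
  by (simp add: umbral_altdef[OF degree_smult_le] umbral_def sum_distrib_left mult.assoc)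

lemma umbral_monom: "umbral u (monom 1 n) = u n"
  by (simp add: umbral_def degree_monom_eq if_distrib if_distribR cong: if_cong)

text \<open>
  \<open>rank_weight z S k\<close> is the total weight \<open>z\<^bsup>|C|\<^esup>\<close> of the chains in \<open>P\<^sub>S\<close> with a given top
  element of rank \<open>k > 0\<close>. The value at rank \<open>0\<close> is that of the empty chain and, if \<open>0 \<in> S\<close>, of the least element.
\<close>

fun rank_weight :: "complex \<Rightarrow> nat set \<Rightarrow> nat \<Rightarrow> complex" where
  "rank_weight z S 0 = (if 0 \<in> S then 1 + z else 1)"
| "rank_weight z S (Suc n) =
     (if Suc n \<in> S
      then z * (\<Sum>j\<le>n. of_real (coeff (\<Sum>k\<le>n. h_basis n k pX) j) * rank_weight z S j) else 0)"

text \<open>By \<open>cube_basis_Suc\<close> at \<open>i = 0\<close>, the sum of the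
  \<open>h_basis n k\<close> is the f-polynomial of a cube of rank \<open>Suc n\<close> without its
  top, so the recursion collects the chains strictly below a new top. The defining equation lists
  coefficients to bound the indices of the recursive calls.\<close>

lemma rank_weight_Suc:
  "rank_weight z S (Suc n) =
     (if Suc n \<in> S then z * (\<Sum>k\<le>n. umbral (rank_weight z S) (h_basis n k pX)) else 0)"
proof -
  have "degree (\<Sum>k\<le>n. h_basis n k pX) \<le> n"
    by (intro degree_sum_le degree_h_basis_le) simp_all
  then show ?thesis
    unfolding umbral_sum[symmetric] by (simp add: umbral_altdef)
qed

declare rank_weight.simps(2) [simp del]

lemma umbral_cube_basis_Suc:
  assumes "i \<le> Suc n"
  shows "umbral u (cube_basis (Suc n) i pX) = (\<Sum>k=i..n. umbral u (h_basis n k pX)) + u (Suc n)"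
  unfolding cube_basis_Suc[OF assms] umbral_add umbral_sum pX_power umbral_monom h_basis_def ..

lemma umbral_h_basis:
  "umbral u (h_basis n i pX) = of_real (cube_mult n i) * umbral u (cube_basis n i pX)"
proof -
  have "h_basis n i pX = smult (cube_mult n i) (cube_basis n i pX)"
    by (simp add: h_basis_def cube_mult_def numeral_mult_conv_smult)
  then show ?thesis by (simp add: umbral_smult)
qed

lemma Im_over_one_plus:
  assumes "0 < Im z"
  shows "0 < Im (z / (1 + z))" "1 + z \<noteq> 0"
proof -
  show *: "1 + z \<noteq> 0"
  proof
    assume "1 + z = 0"
    then have "Im (1 + z) = 0" by (simp only: zero_complex.sel)
    with assms show False by simp
  qed
  have "Im (z / (1 + z)) = Im z / (cmod (1 + z))\<^sup>2"
    unfolding Im_divide cmod_power2 by (simp add: algebra_simps)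
  with assms * show "0 < Im (z / (1 + z))" by simp
qed

text \<open>With tail \<open>A\<close> and head \<open>C\<close> of the previous values, a selected
  rank adds \<open>z * (A + C)\<close> to \<open>A\<close>. The result is
  \<open>(1 + z) * (A + y * C)\<close> for \<open>y = z / (1 + z)\<close>, which explains the choice
  of \<open>y\<close>. An unselected rank adds nothing.\<close>

lemma sector_ordered_h_basis:
  assumes z: "0 < Im z"
  shows "sector_ordered (z / (1 + z)) (\<lambda>i. umbral (rank_weight z S) (h_basis n i pX)) n"
proof (induction n)
  case 0
  have "umbral (rank_weight z S) 1 = rank_weight z S 0"
    using umbral_monom[of _ 0] by simp
  moreover have "0 \<le> Im (z / (1 + z) * (x * cnj x))" for x
    using Im_over_one_plus(1)[OF z] by (rule Im_mult_cnj_self_nonneg)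
  ultimately show ?case
    using Im_over_one_plus(2)[OF z]
    by (simp add: sector_ordered_def h_basis_def cube_mult_def cube_basis_def
        mult.assoc del: times_complex.sel times_divide_eq_left)
next
  case (Suc n)
  define y where "y = z / (1 + z)"
  have nz: "1 + z \<noteq> 0" using Im_over_one_plus(2)[OF z] .
  have y: "0 < Im y" using Im_over_one_plus(1)[OF z] by (simp add: y_def)
  define w where "w i = umbral (rank_weight z S) (h_basis n i pX)" for i
  define d where "d i = (cube_mult (Suc n) i :: real)" for i
  define e where "e = (if Suc n \<in> S then y else 0)"
  \<comment> \<open>the two parts of \<open>(1 + z) A + z C\<close> are brought to the form \<open>A + y C\<close> by scaling\<close>
  define c where "c = (if Suc n \<in> S then 1 + z else 1)"
  have "c \<noteq> 0" using nz by (simp add: c_def)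
  have eq: "umbral (rank_weight z S) (h_basis (Suc n) i pX)
      = of_real (d i) * (c * (sum w {i..n} + e * sum w {..<i}))" if "i \<le> Suc n" for i
  proof -
    have "{..n} = {..<i} \<union> {i..n}" using that by auto
    then have "sum w {..n} = sum w {..<i} + sum w {i..n}"
      by (simp add: sum.union_disjoint ivl_disj_int)
    then have "rank_weight z S (Suc n) = (if Suc n \<in> S then z * (sum w {..<i} + sum w {i..n}) else 0)"
      unfolding rank_weight_Suc w_def by simp
    then show ?thesis
      using nz unfolding umbral_h_basis[of _ "Suc n"] umbral_cube_basis_Suc[OF that] w_def[symmetric] d_def[symmetric]
      by (simp add: c_def e_def y_def field_simps)
  qed
  have "sector_ordered y (\<lambda>i. of_real (d i) * (c * (sum w {i..n} + e * sum w {..<i}))) (Suc n)"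
    using Suc[folded y_def w_def] y \<open>c \<noteq> 0\<close>
    by (intro sector_ordered_weights sector_ordered_scale sector_ordered_tails)
      (auto simp: d_def cube_mult_def e_def)
  then show ?case
    unfolding y_def[symmetric] by (rule sector_ordered_cong[OF _ eq])
qed

text \<open>Nonnegative weights keep the sector order, and \<open>h 0 \<noteq> 0\<close> preserves
  its nonvanishing first entry.\<close>

lemma h_basis_combination_nonzero:
  assumes "0 < Im z" "\<And>i. i \<le> n \<Longrightarrow> 0 \<le> h i" "h 0 \<noteq> 0"
  shows "umbral (rank_weight z S) (\<Sum>i\<le>n. smult (h i) (h_basis n i pX)) \<noteq> 0"
  unfolding umbral_sum umbral_smult
  by (rule sector_ordered_sum_nonzero[OF sector_ordered_weights[OF sector_ordered_h_basis]])
    (use assms Im_over_one_plus in auto)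

section \<open>Expansion of the f-polynomial with the h-vector as coefficients\<close>

lemma poly_h_basis: "poly (h_basis n i p) s = h_basis n i (poly p s)"
  by (simp add: h_basis_def cube_basis_def cube_mult_def)

lemma poly_eq_except:
  fixes p q :: "'a::{idom, ring_char_0} poly"
  assumes "\<And>s. s \<noteq> a \<Longrightarrow> poly p s = poly q s"
  shows "p = q"
proof -
  have "UNIV - {a} \<subseteq> {s. poly (p - q) s = 0}"
    using assms by auto
  then have "infinite {s. poly (p - q) s = 0}"
    using infinite_super[of "UNIV - {a}"] by (simp add: infinite_UNIV_char_0)
  then show ?thesis
    using poly_roots_finite[of "p - q"] by auto
qed

text \<open>The substitution \<open>t = s / (2 + s)\<close> inverts
  \<open>s = 2 * t / (1 - t)\<close>; clearing denominators expresses
  \<open>(2 + s) * poly f s\<close> through \<open>h\<close>. The two correction terms are then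
  identified as multiples of the first and last h-numbers.\<close>

lemma f_poly_h_basis:
  assumes fin: "finite (Field r)"
  shows "f_poly r = (\<Sum>i\<le>poset_rank r. smult (coeff (h_poly r) i) (h_basis (poset_rank r) i pX))"
    and "coeff (h_poly r) 0 = coeff (f_poly r) 0"
proof -
  define n f h where "n = poset_rank r" and "f = f_poly r" and "h = h_poly r"
  have deg: "degree h \<le> n" unfolding h_def n_def using is_h_poly_h_poly[OF fin] by simp
  have eq: "(1 + t) * poly h t = (-1) ^ n * poly f (-1) * t ^ (n + 1) + poly f 0 * (1 - ((1 - t) / 2) ^ n)
          + ((1 - t) / 2) ^ n * poly f (2 * t / (1 - t))" if "t \<noteq> 1" for t
    using is_h_poly_h_poly(1)[OF fin] that unfolding is_h_poly_def n_def f_def h_def by blast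
  show h0: "coeff (h_poly r) 0 = coeff (f_poly r) 0"
    using eq[of 0] by (simp add: h_def f_def poly_0_coeff_0 algebra_simps)
  have key: "poly f s * (2 + s) = (\<Sum>i\<le>n. coeff h i * (2 * (1 + s) * s ^ i * (2 + s) ^ (n - i)))
      - (-1) ^ n * poly f (-1) * s ^ (n + 1) - poly f 0 * ((2 + s) ^ (n + 1) - (2 + s))"
    if s: "s \<noteq> -2" for s
  proof -
    have s2: "2 + s \<noteq> 0" using s by simp
    define t where "t = s / (2 + s)"
    have t: "t \<noteq> 1" "1 + t = 2 * (1 + s) / (2 + s)" "(1 - t) / 2 = 1 / (2 + s)" "2 * t / (1 - t) = s"
      using s2 by (auto simp: t_def field_simps)
    have ph0: "poly h t = (\<Sum>i\<le>n. coeff h i * t ^ i)"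
      unfolding poly_altdef using deg by (intro sum.mono_neutral_left) (auto simp: coeff_eq_0)
    have ph: "(2 + s) ^ n * poly h t = (\<Sum>i\<le>n. coeff h i * (s ^ i * (2 + s) ^ (n - i)))"
      unfolding ph0 sum_distrib_left
    proof (rule sum.cong)
      fix i assume "i \<in> {..n}"
      then have "(2 + s) ^ n = (2 + s) ^ i * (2 + s) ^ (n - i)" by (simp flip: power_add)
      then show "(2 + s) ^ n * (coeff h i * t ^ i) = coeff h i * (s ^ i * (2 + s) ^ (n - i))"
        using s2 by (simp add: t_def power_divide)
    qed simp
    have "2 * (1 + s) * ((2 + s) ^ n * poly h t) = (2 + s) ^ (n + 1) * ((1 + t) * poly h t)"
      using s2 by (simp add: t(2))
    also have "\<dots> = (2 + s) ^ (n + 1) * ((-1) ^ n * poly f (-1) * t ^ (n + 1))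
        + (2 + s) ^ (n + 1) * (poly f 0 * (1 - (1 / (2 + s)) ^ n)) + (2 + s) ^ (n + 1) * ((1 / (2 + s)) ^ n * poly f s)"
      by (simp only: eq[OF t(1)] t(3,4) distrib_left)
    also have "\<dots> = (-1) ^ n * poly f (-1) * s ^ (n + 1) + poly f 0 * ((2 + s) ^ (n + 1) - (2 + s)) + (2 + s) * poly f s"
    proof -
      have t': "(2 + s) ^ (n + 1) * t ^ (n + 1) = s ^ (n + 1)"
        using s2 by (simp add: t_def flip: power_mult_distrib del: power_Suc)
      have q: "(2 + s) ^ n * (1 / (2 + s)) ^ n = 1"
        using s2 by (simp flip: power_mult_distrib)
      have "(2 + s) ^ (n + 1) * (1 / (2 + s)) ^ n = (2 + s) * ((2 + s) ^ n * (1 / (2 + s)) ^ n)"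
        by simp
      also have "\<dots> = 2 + s"
        by (simp only: q mult_1_right)
      finally have q': "(2 + s) ^ (n + 1) * (1 / (2 + s)) ^ n = 2 + s" .
      have *: "a * (b * T) + a * (c * (1 - d)) + a * (d * F) = b * (a * T) + c * (a - a * d) + (a * d) * F"
        for a b c d T F :: real
        by (simp add: algebra_simps)
      show ?thesis
        unfolding * t' q' ..
    qed
    finally show ?thesis unfolding ph by (simp add: sum_distrib_left algebra_simps)
  qed
  define R where "R = (\<Sum>i\<le>n. smult (coeff h i) (2 * (1 + pX) * pX ^ i * (2 + pX) ^ (n - i)))
      - smult ((-1) ^ n * poly f (-1)) (pX ^ (n + 1)) - smult (poly f 0) ((2 + pX) ^ (n + 1) - (2 + pX))"
  have R: "poly R s = (\<Sum>i\<le>n. coeff h i * (2 * (1 + s) * s ^ i * (2 + s) ^ (n - i)))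
      - (-1) ^ n * poly f (-1) * s ^ (n + 1) - poly f 0 * ((2 + s) ^ (n + 1) - (2 + s))" for s
    unfolding R_def by (simp add: poly_sum poly_monom)
  \<comment> \<open>\<open>key\<close> excludes \<open>s = -2\<close>, but the polynomial identity
    can be evaluated there: the left side vanishes and only the summand \<open>i = n\<close>
    survives in the sum, which gives \<open>hn\<close>.\<close>
  have "f * (2 + pX) = R"
    using key by (intro poly_eq_except[of "-2"]) (simp add: R poly_monom)
  then have "poly R (-2) = 0"
    by (metis add.right_inverse mult_zero_right poly_add poly_monom poly_mult poly_numeral power_one_right mult_1)
  moreover have "(\<Sum>i\<le>n. coeff h i * (2 * (1 + - 2) * (- 2) ^ i * (2 + - 2) ^ (n - i))) = - 2 * coeff h n * (-2) ^ n"
  proof -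
    have "(\<Sum>i\<le>n. coeff h i * (2 * (1 + - 2) * (- 2) ^ i * (2 + - 2) ^ (n - i)))
        = (\<Sum>i\<in>{n}. coeff h i * (2 * (1 + - 2) * (- 2) ^ i * (2 + - 2) ^ (n - i)))"
      by (rule sum.mono_neutral_right) auto
    then show ?thesis by simp
  qed
  ultimately have "(-2) ^ n * (coeff h n - (-1) ^ n * poly f (-1)) = 0"
    unfolding R by (simp add: algebra_simps)
  then have hn: "(-1) ^ n * poly f (-1) = coeff h n" by simp
  have h0': "poly f 0 = coeff h 0" using h0 by (simp add: h_def f_def poly_0_coeff_0)
  have "poly f s = poly (\<Sum>i\<le>n. smult (coeff h i) (h_basis n i pX)) s" if s: "s \<noteq> -2" for s
  proof -
    have s2: "2 + s \<noteq> 0" using s by simp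
    \<comment> \<open>Moves the correction terms into the summands \<open>n\<close> and
      \<open>0\<close>; for \<open>n = 0\<close> both fall on the same summand.\<close>
    have *: "(\<Sum>i\<le>n. a i * (b i - (if i = n then X else 0) - (if i = 0 then Y else 0)))
        = (\<Sum>i\<le>n. a i * b i) - a n * X - a 0 * Y" for a b :: "nat \<Rightarrow> real" and X Y
      by (simp add: right_diff_distrib sum_subtractf if_distrib[of "(*) _"] cong: if_cong)
    have "poly f s * (2 + s) = (\<Sum>i\<le>n. coeff h i * (2 * (1 + s) * s ^ i * (2 + s) ^ (n - i)
        - (if i = n then s ^ (n + 1) else 0) - (if i = 0 then (2 + s) ^ (n + 1) - (2 + s) else 0)))"
      unfolding key[OF s] hn h0' * ..
    also have "\<dots> = (\<Sum>i\<le>n. coeff h i * (h_basis n i s * (2 + s)))"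
    proof (intro sum.cong refl arg_cong2[where f = "(*)"])
      fix i assume i: "i \<in> {..n}"
      consider "i = 0" "n = 0" | m where "i = 0" "n = Suc m" | "0 < i" "i = n"
        | m where "0 < i" "n = Suc (i + m)"
        using i by (metis Suc_diff_Suc add_Suc_right le_add_diff_inverse le_neq_implies_less
            not0_implies_Suc zero_less_iff_neq_zero atMost_iff)
      then show "2 * (1 + s) * s ^ i * (2 + s) ^ (n - i) - (if i = n then s ^ (n + 1) else 0)
          - (if i = 0 then (2 + s) ^ (n + 1) - (2 + s) else 0) = h_basis n i s * (2 + s)"
        by cases (auto simp: h_basis_def cube_basis_def cube_mult_def algebra_simps)
    qed
    also have "\<dots> = (\<Sum>i\<le>n. coeff h i * h_basis n i s) * (2 + s)"
      by (simp add: sum_distrib_right mult.assoc)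
    finally show ?thesis using s2 by (simp add: poly_sum poly_h_basis poly_monom)
  qed
  then show "f_poly r = (\<Sum>i\<le>poset_rank r. smult (coeff (h_poly r) i) (h_basis (poset_rank r) i pX))"
    unfolding f_def[symmetric] h_def[symmetric] n_def[symmetric]
    by (rule poly_eq_except)
qed

section \<open>Rank numbers of principal ideals\<close>

text \<open>A sequence below \<open>x\<close> is free exactly where \<open>x\<close> is
  \<open>M_z\<close>, and each such coordinate contributes a factor
  \<open>1 + 1 + s\<close>.\<close>

lemma sum_seqs_below:
  fixes x :: "nat \<Rightarrow> m2" and s :: "'a::comm_ring_1"
  assumes fin: "finite {i. x i = M_z}"
  shows "(\<Sum>y | y \<le> x. s ^ card {i. y i = M_z}) = (2 + s) ^ card {i. x i = M_z}"
proof -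
  let ?K = "{i. x i = M_z}"
  have "a \<in> {M_one, M_two, M_z}" for a
    by (cases a) auto
  then have U: "(UNIV :: m2 set) = {M_one, M_two, M_z}"
    by blast
  have "(\<Sum>y | y \<le> x. s ^ card {i. y i = M_z})
      = (\<Sum>y\<in>?K \<rightarrow>\<^sub>E UNIV. \<Prod>i\<in>?K. if y i = M_z then s else 1)"
  proof (rule sum.reindex_bij_witness[where j = "\<lambda>y. restrict y ?K" and i = "\<lambda>y i. if i \<in> ?K then y i else x i"])
    fix y assume y: "y \<in> {y. y \<le> x}"
    then show "(\<lambda>i. if i \<in> ?K then restrict y ?K i else x i) = y"
      unfolding le_fun_def less_eq_m2_def by (auto simp: fun_eq_iff) metis
    have "{i. y i = M_z} = {i \<in> ?K. y i = M_z}"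
      using y by (force simp: le_fun_def less_eq_m2_def)
    then show "(\<Prod>i\<in>?K. if restrict y ?K i = M_z then s else 1) = s ^ card {i. y i = M_z}"
      using fin by (simp add: prod.If_cases Int_def conj_commute cong: conj_cong)
  qed (auto simp: le_fun_def less_eq_m2_def fun_eq_iff PiE_def extensional_def)
  also have "\<dots> = (\<Prod>i\<in>?K. \<Sum>a\<in>UNIV. if a = M_z then s else 1)"
    using fin by (subst prod_sum_PiE) (auto simp: U)
  also have "(\<Sum>a\<in>UNIV. if a = M_z then s else 1) = 2 + s"
    by (simp add: U)
  finally show ?thesis by simp
qed

lemma sum_cube:
  fixes s :: "'a::comm_ring_1"
  assumes "c \<in> C2"
  shows "(\<Sum>d\<in>under C2_rel c. s ^ C2_rank d) = cube_basis (C2_rank c) 0 s"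
proof (cases c)
  case None
  then have "under C2_rel c = {None}"
    by (auto simp: under_def C2_rel_def relation_of_def C2_def)
  then show ?thesis using None by (simp add: cube_basis_def)
next
  case (Some x)
  have E: "a \<notin> {M_one, M_two} \<longleftrightarrow> a = M_z" for a
    by (cases a) auto
  have fin: "finite {i. x i = M_z}"
    using assms Some unfolding C2_def E by auto
  have sub: "finite {i. y i = M_z}" if "y \<le> x" for y
    by (rule finite_subset[OF _ fin]) (use that in \<open>force simp: le_fun_def less_eq_m2_def\<close>)
  have "under C2_rel c = insert None (Some ` {y. y \<le> x})"
    using Some fin sub unfolding under_def C2_rel_def relation_of_def C2_def E
    by auto
  then show ?thesis
    using Some card_seqs_below[OF fin] sum_seqs_below[OF fin, of s]
    by (simp add: sum.reindex cube_basis_def sum_distrib_left[symmetric])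
qed

text \<open>An isomorphism of ideals restricts to the ideals below \<open>y\<close> and
  \<open>f y\<close>; hence ranks in \<open>r\<close> can be read off in the model cube.\<close>

lemma principal_ideal_is_cube:
  assumes po: "Partial_order r" and x: "x \<in> Field r"
    and f: "iso (principal_ideal r x) (principal_ideal C2_rel c) f" and c: "c \<in> C2"
    and y: "y \<in> under r x"
  shows "is_cube (C2_rank (f y)) (principal_ideal r y)" "f y \<in> under C2_rel c"
proof -
  have bij: "bij_betw f (under r x) (under C2_rel c)"
    and ord: "\<And>a b. a \<in> under r x \<Longrightarrow> b \<in> under r x \<Longrightarrow> (a, b) \<in> r \<longleftrightarrow> (f a, f b) \<in> C2_rel"
    using f unfolding iso_iff2 Field_principal_ideal[OF po x]
      Field_principal_ideal[OF Partial_order_C2_rel, unfolded Field_C2_rel, OF c]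
    by (auto simp: principal_ideal_def bij_betw_def)
  show fy: "f y \<in> under C2_rel c" using bij y by (auto simp: bij_betw_def)
  then have fyC: "f y \<in> C2" by (auto simp: under_def C2_rel_def relation_of_def)
  have yF: "y \<in> Field r" using y by (auto simp: under_def Field_def)
  have tr: "trans r" "trans C2_rel" using po Partial_order_C2_rel by (auto simp: order_on_defs)
  have suby: "under r y \<subseteq> under r x" and subc: "under C2_rel (f y) \<subseteq> under C2_rel c"
    using y fy tr by (auto simp: under_def dest: transD)
  have "bij_betw f (under r y) (under C2_rel (f y))"
  proof (rule bij_betw_subset[OF bij suby])
    show "f ` under r y = under C2_rel (f y)"
    proof
      show "f ` under r y \<subseteq> under C2_rel (f y)"
        using ord y suby by (auto simp: under_def)
      show "under C2_rel (f y) \<subseteq> f ` under r y"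
      proof
        fix d assume d: "d \<in> under C2_rel (f y)"
        then obtain a where "a \<in> under r x" "d = f a"
          using bij subc unfolding bij_betw_def by blast
        with d ord y show "d \<in> f ` under r y" by (auto simp: under_def)
      qed
    qed
  qed
  then have "iso (principal_ideal r y) (principal_ideal C2_rel (f y)) f"
    unfolding iso_iff2 Field_principal_ideal[OF po yF]
      Field_principal_ideal[OF Partial_order_C2_rel, unfolded Field_C2_rel, OF fyC]
    using ord suby by (auto simp: principal_ideal_def bij_betw_def)
  then show "is_cube (C2_rank (f y)) (principal_ideal r y)"
    unfolding is_cube_def using fyC by blast
qed

lemma sum_principal_ideal:
  fixes s :: "'b::comm_ring_1"
  assumes P: "cubical_poset r" and x: "x \<in> Field r"
  shows "(\<Sum>y\<in>under r x. s ^ elem_rank r y) = cube_basis (elem_rank r x) 0 s"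
proof -
  have po: "Partial_order r" using P by (simp add: cubical_poset_def)
  obtain c f where c: "c \<in> C2" and f: "iso (principal_ideal r x) (principal_ideal C2_rel c) f"
    and ec: "elem_rank r x = C2_rank c"
    using P x elem_rank_eq unfolding cubical_poset_def is_cube_def by metis
  have e: "elem_rank r y = C2_rank (f y)" if "y \<in> under r x" for y
    using principal_ideal_is_cube(1)[OF po x f c that] elem_rank_eq by metis
  have bij: "bij_betw f (under r x) (under C2_rel c)"
    using f c x by (simp add: iso_def Field_principal_ideal[OF po] Field_principal_ideal[OF Partial_order_C2_rel] Field_C2_rel)
  show ?thesis
    unfolding ec sum_cube[OF c, symmetric] sum.reindex_bij_betw[OF bij, symmetric]
    using e by simp
qed

section \<open>Counting chains by their top element\<close>

text \<open>Restricting the set instead of the relation keeps \<open>r\<close> fixed throughout the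
  recursion.\<close>

definition chain_gf :: "'a rel \<Rightarrow> complex \<Rightarrow> 'a set \<Rightarrow> complex" where
  "chain_gf r z A = (\<Sum>C | C \<in> Chains r \<and> C \<subseteq> A. z ^ card C)"

lemma finite_chain_has_max:
  assumes po: "Partial_order r" and "finite C" "C \<noteq> {}" "C \<in> Chains r"
  shows "\<exists>x\<in>C. C - {x} \<subseteq> underS r x"
  using assms(2-)
proof (induction rule: finite_ne_induct)
  case (insert a C)
  then obtain x where x: "x \<in> C" "C - {x} \<subseteq> underS r x"
    by (auto simp: Chains_def)
  have "(a, x) \<in> r \<or> (x, a) \<in> r"
    using insert.prems x by (auto simp: Chains_def)
  then show ?case
    using x po insert.hyps by (fastforce simp: underS_def order_on_defs dest: transD)
qed simp

text \<open>Nonempty chains are grouped by their largest element \<open>x\<close>; removing it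
  leaves an arbitrary chain of \<open>A\<close> strictly below \<open>x\<close>.\<close>

lemma chain_gf_rec:
  assumes po: "Partial_order r" and fin: "finite A" and A: "A \<subseteq> Field r"
  shows "chain_gf r z A = 1 + z * (\<Sum>x\<in>A. chain_gf r z (A \<inter> underS r x))"
proof -
  define K where "K x = {C. C \<in> Chains r \<and> C \<subseteq> A \<inter> underS r x}" for x
  have anti: "antisym r" and refl: "\<And>x. x \<in> A \<Longrightarrow> (x, x) \<in> r"
    using po A by (auto simp: order_on_defs refl_on_def)
  have finK: "finite (K x)" for x
    unfolding K_def by (rule finite_subset[of _ "Pow A"]) (use fin in auto)
  have eq: "{C. C \<in> Chains r \<and> C \<subseteq> A} = insert {} (\<Union>x\<in>A. insert x ` K x)"
  proof (intro equalityI subsetI)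
    fix C assume C: "C \<in> {C. C \<in> Chains r \<and> C \<subseteq> A}"
    show "C \<in> insert {} (\<Union>x\<in>A. insert x ` K x)"
    proof (cases "C = {}")
      case False
      then obtain x where x: "x \<in> C" "C - {x} \<subseteq> underS r x"
        using finite_chain_has_max[OF po, of C] C finite_subset[OF _ fin, of C] by blast
      then have "C - {x} \<in> K x" using C unfolding K_def Chains_def by blast
      then have "insert x (C - {x}) \<in> insert x ` K x" by blast
      moreover have "insert x (C - {x}) = C" "x \<in> A" using x C by blast+
      ultimately show ?thesis by (metis UN_I insertI2)
    qed simp
  next
    fix C assume "C \<in> insert {} (\<Union>x\<in>A. insert x ` K x)"
    then consider "C = {}" | x D where "x \<in> A" "D \<in> K x" "C = insert x D" by blast
    then show "C \<in> {C. C \<in> Chains r \<and> C \<subseteq> A}"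
    proof cases
      case 2
      then show ?thesis
        using refl[OF \<open>x \<in> A\<close>] unfolding K_def Chains_def underS_def by blast
    qed (simp add: Chains_def)
  qed
  \<comment> \<open>A common chain would put each of the two tops strictly below the other.\<close>
  have disj: "insert x ` K x \<inter> insert y ` K y = {}" if "x \<noteq> y" for x y
  proof -
    have False if "insert x C = insert y D" "C \<in> K x" "D \<in> K y" for C D
    proof -
      have "x \<in> underS r y" "y \<in> underS r x"
        using that(2,3) \<open>x \<noteq> y\<close> insertI1[of x C, unfolded that(1)]
          insertI1[of y D, folded that(1)] unfolding K_def by blast+
      with antisymD[OF anti, of x y] \<open>x \<noteq> y\<close> show False by (simp add: underS_def)
    qed
    then show ?thesis by blast
  qed
  have inner: "(\<Sum>C\<in>insert x ` K x. z ^ card C) = z * chain_gf r z (A \<inter> underS r x)" for x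
  proof -
    have gf: "chain_gf r z (A \<inter> underS r x) = (\<Sum>C\<in>K x. z ^ card C)"
      by (simp add: chain_gf_def K_def)
    have notin: "x \<notin> C" if "C \<in> K x" for C
      using that by (auto simp: K_def underS_def)
    have "inj_on (insert x) (K x)"
      by (rule inj_onI) (simp add: insert_ident notin)
    moreover have "card (insert x C) = Suc (card C)" if "C \<in> K x" for C
      using notin[OF that] that finite_subset[OF _ fin, of C] unfolding K_def by simp
    ultimately show ?thesis
      by (simp add: sum.reindex gf sum_distrib_left)
  qed
  have "chain_gf r z A = (\<Sum>C\<in>insert {} (\<Union>x\<in>A. insert x ` K x). z ^ card C)"
    unfolding chain_gf_def eq ..
  also have "\<dots> = 1 + (\<Sum>x\<in>A. \<Sum>C\<in>insert x ` K x. z ^ card C)"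
  proof (subst sum.insert)
    show "{} \<notin> (\<Union>x\<in>A. insert x ` K x)" by blast
  qed (use fin finK disj in \<open>simp_all add: sum.UNION_disjoint\<close>)
  finally show ?thesis unfolding inner by (simp add: sum_distrib_left)
qed

text \<open>At \<open>s = 1\<close> the rank sum counts the ideal: one element for rank
  \<open>0\<close>, at least two otherwise. The count is made in \<open>int\<close> because
  \<open>cube_basis\<close> needs a ring.\<close>

lemma bottom_rank:
  assumes P: "cubical_poset r"
  obtains b where "b \<in> Field r" "\<And>x. x \<in> Field r \<Longrightarrow> (b, x) \<in> r"
    "\<And>x. x \<in> Field r \<Longrightarrow> elem_rank r x = 0 \<longleftrightarrow> x = b"
proof -
  have po: "Partial_order r" and fin: "finite (Field r)" using P by (simp_all add: cubical_poset_def)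
  obtain b where b: "b \<in> Field r" "\<And>x. x \<in> Field r \<Longrightarrow> (b, x) \<in> r"
    using P unfolding cubical_poset_def by blast
  have *: "card (under r x) = (if elem_rank r x = 0 then 1 else Suc (3 ^ (elem_rank r x - 1)))" if "x \<in> Field r" for x
  proof -
    have "int (card (under r x)) = int (if elem_rank r x = 0 then 1 else Suc (3 ^ (elem_rank r x - 1)))"
      using sum_principal_ideal[OF P that, of "1 :: int"] by (simp add: cube_basis_def)
    then show ?thesis by (simp only: of_nat_eq_iff)
  qed
  have "elem_rank r x = 0 \<longleftrightarrow> x = b" if x: "x \<in> Field r" for x
  proof
    assume "elem_rank r x = 0"
    then have "card (under r x) = 1" using * x by simp
    moreover have "b \<in> under r x" "x \<in> under r x"
      using b x po by (auto simp: under_def order_on_defs refl_on_def)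
    ultimately show "x = b" by (auto simp: card_1_singleton_iff)
  next
    assume "x = b"
    then have "under r x = {b}"
      using b po by (auto simp: under_def order_on_defs dest: antisymD)
    then show "elem_rank r x = 0" using *[OF x] by (auto split: if_splits)
  qed
  with b that show ?thesis by blast
qed
lemma sum_monom_principal_ideal:
  assumes "cubical_poset r" "x \<in> Field r"
  shows "(\<Sum>y\<in>under r x. monom 1 (elem_rank r y)) = cube_basis (elem_rank r x) 0 pX"
  using sum_principal_ideal[OF assms, of pX] by (simp only: pX_power)

text \<open>Hypothesis \<open>w\<close> is filled by the induction hypothesis when \<open>T\<close>
  is the set strictly below an element, and by \<open>rank_weight_chain_gf\<close> when
  \<open>T\<close> is the whole poset.\<close>

lemma chain_gf_lower_set:
  assumes P: "cubical_poset r" and T: "T \<subseteq> Field r" and b: "\<exists>y\<in>T. elem_rank r y = 0"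
    and down: "\<And>y. y \<in> T \<Longrightarrow> underS r y \<subseteq> T"
    and w: "\<And>y. y \<in> T \<Longrightarrow> elem_rank r y \<noteq> 0 \<Longrightarrow> rank_weight z S (elem_rank r y)
       = (if elem_rank r y \<in> S
          then z * chain_gf r z ({y \<in> Field r. elem_rank r y \<in> S} \<inter> underS r y) else 0)"
  shows "chain_gf r z ({y \<in> Field r. elem_rank r y \<in> S} \<inter> T) = (\<Sum>y\<in>T. rank_weight z S (elem_rank r y))"
proof -
  define B where "B = {y \<in> Field r. elem_rank r y \<in> S}"
  have po: "Partial_order r" and fin: "finite (Field r)"
    using P by (simp_all add: cubical_poset_def)
  have finT: "finite T" using T fin finite_subset by blast
  obtain b where bF: "b \<in> Field r" and bmin: "\<And>x. x \<in> Field r \<Longrightarrow> (b, x) \<in> r"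
    and b0: "\<And>x. x \<in> Field r \<Longrightarrow> elem_rank r x = 0 \<longleftrightarrow> x = b"
    using bottom_rank[OF P] by blast
  have bT: "b \<in> T" using b b0 T by auto
  define g where "g y = (if elem_rank r y \<in> S then z * chain_gf r z (B \<inter> underS r y) else 0)" for y
  have "underS r b = {}"
  proof -
    have "antisym r" using po by (simp add: order_on_defs)
    then have False if "y \<in> underS r b" for y
      using that bmin[of y] unfolding underS_def by (blast dest: antisymD intro: FieldI1)
    then show ?thesis by blast
  qed
  moreover have "chain_gf r z {} = 1"
    using chain_gf_rec[OF po finite.emptyI empty_subsetI, of z]
    by (simp only: sum.empty mult_zero_right add_0_right)
  \<comment> \<open>The empty chain and the bottom element together account for the value of
    \<open>rank_weight\<close> at rank \<open>0\<close>.\<close>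
  ultimately have gb: "1 + g b = rank_weight z S (elem_rank r b)"
    using b0[OF bF] by (simp add: g_def)
  have "chain_gf r z (B \<inter> T) = 1 + z * (\<Sum>y\<in>B \<inter> T. chain_gf r z (B \<inter> T \<inter> underS r y))"
    using T finT by (intro chain_gf_rec[OF po]) auto
  also have "(\<Sum>y\<in>B \<inter> T. chain_gf r z (B \<inter> T \<inter> underS r y)) = (\<Sum>y\<in>B \<inter> T. chain_gf r z (B \<inter> underS r y))"
    using down by (intro sum.cong refl arg_cong[where f = "chain_gf r z"]) blast
  also have "z * \<dots> = (\<Sum>y\<in>B \<inter> T. g y)"
    unfolding sum_distrib_left by (intro sum.cong) (auto simp: g_def B_def)
  also have "\<dots> = (\<Sum>y\<in>T. g y)"
    by (rule sum.mono_neutral_left) (use finT T in \<open>auto simp: g_def B_def\<close>)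
  also have "\<dots> = g b + (\<Sum>y\<in>T - {b}. g y)"
    using bT finT by (simp add: sum.remove)
  also have "(\<Sum>y\<in>T - {b}. g y) = (\<Sum>y\<in>T - {b}. rank_weight z S (elem_rank r y))"
  proof (rule sum.cong)
    fix y assume "y \<in> T - {b}"
    then have y: "y \<in> T" "elem_rank r y \<noteq> 0" using T b0 by blast+
    show "g y = rank_weight z S (elem_rank r y)"
      unfolding g_def B_def by (rule w[OF y, symmetric])
  qed simp
  also have "1 + (g b + \<dots>) = (\<Sum>y\<in>T. rank_weight z S (elem_rank r y))"
    unfolding add.assoc[symmetric] gb using bT finT by (simp add: sum.remove)
  finally show ?thesis unfolding B_def .
qed

text \<open>Below \<open>x\<close> the rank numbers are those of a cube, so summing the weights
  there reproduces the recursion of \<open>rank_weight\<close>.\<close>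

lemma rank_weight_chain_gf:
  assumes P: "cubical_poset r" and x: "x \<in> Field r" and pos: "elem_rank r x \<noteq> 0"
  shows "rank_weight z S (elem_rank r x)
       = (if elem_rank r x \<in> S
          then z * chain_gf r z ({y \<in> Field r. elem_rank r y \<in> S} \<inter> underS r x) else 0)"
  using x pos
proof (induction "card (underS r x)" arbitrary: x rule: less_induct)
  case less
  have po: "Partial_order r" and fin: "finite (Field r)"
    using P by (simp_all add: cubical_poset_def)
  have tr: "trans r" and anti: "antisym r" and refl: "(x, x) \<in> r"
    using po less.prems(1) by (auto simp: order_on_defs refl_on_def)
  obtain n where n: "elem_rank r x = Suc n" using less.prems(2) not0_implies_Suc by blast
  have sub: "underS r x \<subseteq> Field r" by (auto simp: underS_def intro: FieldI1)
  have finx: "finite (underS r x)" using sub fin finite_subset by blast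
  have down: "underS r y \<subset> underS r x" if "y \<in> underS r x" for y
    using that tr anti unfolding underS_def by (blast dest: transD antisymD)
  obtain b where b: "b \<in> Field r" "\<And>x. x \<in> Field r \<Longrightarrow> (b, x) \<in> r"
    "\<And>x. x \<in> Field r \<Longrightarrow> elem_rank r x = 0 \<longleftrightarrow> x = b"
    using bottom_rank[OF P] by blast
  then have "b \<in> underS r x" "elem_rank r b = 0"
    using less.prems by (auto simp: underS_def)
  then have "chain_gf r z ({y \<in> Field r. elem_rank r y \<in> S} \<inter> underS r x)
      = (\<Sum>y\<in>underS r x. rank_weight z S (elem_rank r y))"
    using down sub by (intro chain_gf_lower_set[OF P] less.hyps) (auto intro!: psubset_card_mono finx)
  also have "\<dots> = (\<Sum>k\<le>n. umbral (rank_weight z S) (h_basis n k pX))"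
  proof -
    have "under r x = insert x (underS r x)" using refl by (auto simp: under_def underS_def)
    moreover have "x \<notin> underS r x" by (simp add: underS_def)
    \<comment> \<open>The term of \<open>x\<close> itself cancels against the summand
      \<open>u (Suc n)\<close> of \<open>umbral_cube_basis_Suc\<close>.\<close>
    ultimately have "(\<Sum>y\<in>under r x. rank_weight z S (elem_rank r y))
        = rank_weight z S (Suc n) + (\<Sum>y\<in>underS r x. rank_weight z S (elem_rank r y))"
      using finx n by simp
    moreover have "(\<Sum>y\<in>under r x. rank_weight z S (elem_rank r y))
        = umbral (rank_weight z S) (cube_basis (Suc n) 0 pX)"
      unfolding n[symmetric] sum_monom_principal_ideal[OF P less.prems(1), symmetric]
      by (simp add: umbral_sum umbral_monom)
    ultimately show ?thesis
      using umbral_cube_basis_Suc[of 0 n "rank_weight z S"] by (simp add: atLeast0AtMost)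
  qed
  finally show ?case unfolding n rank_weight_Suc by simp
qed

lemma poly_chain_poly_rank_selected:
  assumes P: "cubical_poset r"
  shows "poly (map_poly of_real (chain_poly (rank_selected r S))) z = umbral (rank_weight z S) (f_poly r)"
proof -
  define B where "B = {y \<in> Field r. elem_rank r y \<in> S}"
  have Ch: "Chains (rank_selected r S) = {C. C \<in> Chains r \<and> C \<subseteq> B}"
    unfolding rank_selected_def B_def[symmetric] Chains_def by blast
  obtain b where "b \<in> Field r" "elem_rank r b = 0"
    using bottom_rank[OF P] by metis
  then have "chain_gf r z (B \<inter> Field r) = (\<Sum>y\<in>Field r. rank_weight z S (elem_rank r y))"
    unfolding B_def
    by (intro chain_gf_lower_set[OF P] rank_weight_chain_gf[OF P]) (auto simp: underS_def intro: FieldI1)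
  also have "B \<inter> Field r = B" by (auto simp: B_def)
  finally have "chain_gf r z B = umbral (rank_weight z S) (f_poly r)"
    by (simp add: f_poly_def umbral_sum umbral_monom)
  moreover have "map_poly complex_of_real (\<Sum>C\<in>A. monom 1 (card C)) = (\<Sum>C\<in>A. monom 1 (card C))"
    for A :: "'a set set"
    by (rule poly_eqI) (auto simp: coeff_map_poly coeff_sum intro!: sum.cong)
  ultimately show ?thesis
    by (simp add: chain_poly_def Ch chain_gf_def poly_sum poly_monom)
qed

section \<open>Real-rootedness from nonvanishing in the upper half plane\<close>

lemma real_rooted_upper_half_plane:
  assumes "\<And>z. 0 < Im z \<Longrightarrow> poly (map_poly of_real p) z \<noteq> 0"
  shows "real_rooted p"
  unfolding real_rooted_def
proof (intro allI impI)
  fix z :: complex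
  assume z: "poly (map_poly complex_of_real p) z = 0"
  have "poly (map_poly complex_of_real p) (cnj z) = cnj (poly (map_poly of_real p) z)"
    by (simp add: poly_cnj map_poly_map_poly o_def)
  then have "\<not> 0 < Im z" "\<not> 0 < Im (cnj z)"
    using assms z by auto
  then show "z \<in> \<real>" by (simp add: complex_is_Real_iff)
qed

text \<open>The coefficient \<open>h 0\<close> is positive because it counts the elements of rank
  \<open>0\<close>, among them the bottom.\<close>

lemma real_rooted_rank_selected:
  assumes P: "cubical_poset r" and h: "nonneg_h_vector r"
  shows "real_rooted (chain_poly (rank_selected r S))"
proof (rule real_rooted_upper_half_plane)
  fix z :: complex assume z: "0 < Im z"
  have fin: "finite (Field r)"
    using P by (simp_all add: cubical_poset_def)
  obtain b where b: "b \<in> Field r" "elem_rank r b = 0"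
    using bottom_rank[OF P] by metis
  have "coeff (f_poly r) 0 = (\<Sum>x\<in>Field r. if elem_rank r x = 0 then 1 else 0)"
    by (simp add: f_poly_def coeff_sum)
  also have "\<dots> > 0"
    using b fin by (intro sum_pos2[of _ b]) auto
  finally have "coeff (h_poly r) 0 \<noteq> 0"
    by (simp add: f_poly_h_basis(2)[OF fin])
  then have "umbral (rank_weight z S) (f_poly r) \<noteq> 0"
    unfolding f_poly_h_basis(1)[OF fin]
    using h z by (intro h_basis_combination_nonzero) (auto simp: nonneg_h_vector_def)
  then show "poly (map_poly of_real (chain_poly (rank_selected r S))) z \<noteq> 0"
    by (simp add: poly_chain_poly_rank_selected[OF P])
qed

theorem theorem8p3:
  fixes r :: "'a rel"
  assumes "cubical_poset r" and "nonneg_h_vector r"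
  shows "real_rooted (chain_poly r) \<and>
         (\<forall>S. S \<subseteq> {n. 0 < n} \<longrightarrow> real_rooted (chain_poly (rank_selected r S)))"
proof -
  \<comment> \<open>Rank selection was treated for every set \<open>S\<close>, including those with
    \<open>0\<close>, so the whole poset is the case \<open>S = UNIV\<close>.\<close>
  have "rank_selected r UNIV = r"
    unfolding rank_selected_def by (auto simp: Field_def)
  then show ?thesis
    using real_rooted_rank_selected[OF assms, of UNIV] real_rooted_rank_selected[OF assms] by simp
qed

end
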